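(* Let $L\subset\mathbb{R}^2$ be a lattice whose Voronoi region $\mathcal{P}$ is a hexagon, and let $\Vert\cdot\Vert_{\mathcal{P}}$ be the norm whose unit ball is $\mathcal{P}$. Then $m_1(\mathbb{R}^2,\Vert\cdot\Vert_{\mathcal{P}})=\frac14$.
   Context: The Voronoi region of a lattice $\Lambda\subset\mathbb{R}^n$ is $\mathcal{V}_\Lambda=\{z\in\mathbb{R}^n:\ \langle z-x,z-x\rangle\geq\langle z,z\rangle\ \forall x\in\Lambda\}$ (standard inner product); it is a convex polytope symmetric about the origin. For such a polytope $\mathcal{P}$, $\Vert x\Vert_{\mathcal{P}}=\inf\{\lambda\geq 0: x\in\lambda\mathcal{P}\}$. A set $A$ avoids distance $1$ if $\Vert x-y\Vert\neq1$ for all $x,y\in A$. The density of a measurable $A\subset\mathbb{R}^n$ is $\delta(A)=\limsup_{R\to\infty}\operatorname{Vol}(A\cap[-R,R]^n)/\operatorname{Vol}([-R,R]^n)$, and $m_1(\mathbb{R}^n,\Vert\cdot\Vert)$ is the supremum of $\delta(A)$ over measurable $A$ avoiding distance $1$. *)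

theory Defs
  imports "HOL-Analysis.Analysis"
begin

definition lattice_gen :: "real^2 \<Rightarrow> real^2 \<Rightarrow> (real^2) set" where
  "lattice_gen b1 b2 = {of_int m *\<^sub>R b1 + of_int n *\<^sub>R b2 | m n. True}"

definition is_lattice2 :: "(real^2) set \<Rightarrow> bool" where
  "is_lattice2 L \<longleftrightarrow> (\<exists>b1 b2. independent {b1, b2} \<and> b1 \<noteq> b2 \<and> L = lattice_gen b1 b2)"

definition voronoi :: "(real^2) set \<Rightarrow> (real^2) set" where
  "voronoi L = {z. \<forall>x\<in>L. inner (z - x) (z - x) \<ge> inner z z}"

definition is_hexagon :: "(real^2) set \<Rightarrow> bool" where
  "is_hexagon P \<longleftrightarrow> polytope P \<and> card {v. v extreme_point_of P} = 6"

definition gauge_norm :: "(real^2) set \<Rightarrow> real^2 \<Rightarrow> real" where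
  "gauge_norm P x = Inf {t. t \<ge> 0 \<and> x \<in> (\<lambda>r. t *\<^sub>R r) ` P}"

definition avoids_one :: "(real^2 \<Rightarrow> real) \<Rightarrow> (real^2) set \<Rightarrow> bool" where
  "avoids_one nrm A \<longleftrightarrow> (\<forall>x\<in>A. \<forall>y\<in>A. nrm (x - y) \<noteq> 1)"

definition upper_density :: "(real^2) set \<Rightarrow> ereal" where
  "upper_density A = Limsup at_top (\<lambda>R::real.
      ereal (measure lebesgue (A \<inter> cbox (- (\<chi> i. R)) (\<chi> i. R))
             / measure lebesgue (cbox (- (\<chi> i. R)) ((\<chi> i. R) :: real^2))))"

definition m1 :: "(real^2 \<Rightarrow> real) \<Rightarrow> ereal" where
  "m1 nrm = Sup {upper_density A | A. A \<in> sets lebesgue \<and> avoids_one nrm A}"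

end

(*
  Lower bound: the translates of the open half Voronoi region by L avoid distance 1, and the
  translates of their union by representatives of (L/2)/L cover the plane up to a null set.

  Upper bound: let 2a, -2b, 2c be three consecutive vertices of the hexagon. The vectors 2a, 2b, 2c and the edge midpoints a - b, b - c, c - a all have norm 1.
  Along every orbit of the group generated by a, b, c, count the neighbours z + e, z - e
  (e = a, b, c) of the points of A: a point outside A has at most two neighbours in A, and a
  discharging argument bounds the double counting, so that 4 * 1_A is at most 1 plus a sum of
  terms f (x + d) - f x, whose averages over large boxes vanish. Here a basis u, v with u, v
  and -u-v pairwise at non-acute angles (Selling reduction) gives explicit vertices.
*)
theory Submission
  imports Defs
begin

section \<open>Averages over large squares\<close>

definition box2 :: "real \<Rightarrow> (real^2) set" where
  "box2 R = cbox (- (\<chi> i. R)) (\<chi> i. R)"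

definition box_mean :: "(real^2 \<Rightarrow> real) \<Rightarrow> real \<Rightarrow> real" where
  "box_mean f R = (LINT x:box2 R|lebesgue. f x) / measure lebesgue (box2 R)"

text \<open>Integrability on every square is included because the integral of a non-integrable
  function defaults to 0, which would break additivity.\<close>

definition mean_zero :: "(real^2 \<Rightarrow> real) \<Rightarrow> bool" where
  "mean_zero f \<longleftrightarrow> (\<forall>R. set_integrable lebesgue (box2 R) f) \<and> (box_mean f \<longlongrightarrow> 0) at_top"

lemma mem_box2: "x \<in> box2 R \<longleftrightarrow> (\<forall>i. \<bar>x $ i\<bar> \<le> R)"
  by (auto simp: box2_def mem_box_cart abs_le_iff) (smt (verit))+

lemma box2_mono: "R \<le> S \<Longrightarrow> box2 R \<subseteq> box2 S"
  by (force simp: mem_box2 dest: order.trans)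

lemma lmeasurable_box2 [simp]: "box2 R \<in> lmeasurable"
  by (simp add: box2_def)

lemma measure_box2: "R \<ge> 0 \<Longrightarrow> measure lebesgue (box2 R) = 4 * R\<^sup>2"
proof -
  assume "R \<ge> 0"
  then have "(0 :: real^2) \<in> cbox (- (\<chi> i. R)) (\<chi> i. R)"
    by (simp add: mem_box_cart)
  then show ?thesis
    by (auto simp: box2_def content_cbox_if_cart UNIV_2 power2_eq_square)
qed

lemma set_lebesgue_integral_indicator:
  assumes "B \<in> sets lebesgue"
  shows "set_integrable lebesgue (box2 R) (indicator B :: _ \<Rightarrow> real)"
    and "(LINT x:box2 R|lebesgue. indicator B x) = measure lebesgue (B \<inter> box2 R)"
proof -
  have eq: "(\<lambda>x. indicator (box2 R) x *\<^sub>R (indicator B x :: real)) = indicator (B \<inter> box2 R)"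
    by (auto simp: indicator_def)
  have fm: "B \<inter> box2 R \<in> lmeasurable"
    using assms by (metis Int_commute fmeasurable_Int_fmeasurable lmeasurable_box2)
  then show "set_integrable lebesgue (box2 R) (indicator B :: _ \<Rightarrow> real)"
    unfolding set_integrable_def eq by (simp add: lmeasurable_iff_integrable)
  show "(LINT x:box2 R|lebesgue. indicator B x) = measure lebesgue (B \<inter> box2 R)"
    unfolding set_lebesgue_integral_def eq by simp
qed

lemma box_mean_indicator:
  "B \<in> sets lebesgue \<Longrightarrow>
    box_mean (indicator B) R = measure lebesgue (B \<inter> box2 R) / measure lebesgue (box2 R)"
  by (simp add: box_mean_def set_lebesgue_integral_indicator)

lemma mean_zero_add: "mean_zero f \<Longrightarrow> mean_zero g \<Longrightarrow> mean_zero (\<lambda>x. f x + g x)"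
  unfolding mean_zero_def box_mean_def
  by (auto simp: set_integral_add add_divide_distrib intro: tendsto_add_zero)

lemma mean_zero_minus: "mean_zero f \<Longrightarrow> mean_zero (\<lambda>x. - f x)"
  unfolding mean_zero_def box_mean_def
  by (auto simp: set_integrable_def set_lebesgue_integral_def dest: tendsto_minus)

lemma mean_zero_diff: "mean_zero f \<Longrightarrow> mean_zero g \<Longrightarrow> mean_zero (\<lambda>x. f x - g x)"
  using mean_zero_add[OF _ mean_zero_minus, of f g] by simp

lemma mean_zero_const: "mean_zero (\<lambda>x. 0)"
  by (simp add: mean_zero_def box_mean_def[abs_def] set_integrable_def set_lebesgue_integral_def)

lemma mean_zero_sum: "(\<And>i. i \<in> I \<Longrightarrow> mean_zero (f i)) \<Longrightarrow> mean_zero (\<lambda>x. \<Sum>i\<in>I. f i x)"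
  by (induction I rule: infinite_finite_induct) (auto simp: mean_zero_add mean_zero_const)

lemma mean_zero_negligible:
  assumes "negligible N"
  shows "mean_zero (indicator N)"
proof -
  have N: "N \<in> null_sets lebesgue" and "N \<in> sets lebesgue"
    using assms by (auto simp: negligible_iff_null_sets)
  moreover have "measure lebesgue (N \<inter> box2 R) = 0" for R
    using N by (meson Int_lower1 negligible_iff_null_sets negligible_imp_measure0 negligible_subset)
  ultimately show ?thesis
    by (simp add: mean_zero_def box_mean_def[abs_def] set_lebesgue_integral_indicator)
qed

lemma sets_lebesgue_shift:
  fixes B :: "(real^2) set"
  assumes "B \<in> sets lebesgue"
  shows "{x. x + v \<in> B} \<in> sets lebesgue"
proof -
  have "{x. x + v \<in> B} = (\<lambda>x. - v + x) ` B"
    by (auto simp: image_iff intro!: bexI[of _ "_ + v"])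
  then show ?thesis
    using lebesgue_sets_translation[OF assms, of "- v"] by simp
qed

text \<open>Translating the square by \<open>v\<close> affects only a frame along its boundary,
  whose area is of order \<open>R\<close>, against \<open>4 * R\<^sup>2\<close> for the square
  itself.\<close>

lemma mean_zero_shift:
  assumes B: "B \<in> sets lebesgue"
  shows "mean_zero (\<lambda>x. indicator B (x + v) - indicator B x)"
proof -
  let ?S = "{x. x + v \<in> B}"
  define c where "c = norm v"
  have S: "?S \<in> sets lebesgue"
    by (rule sets_lebesgue_shift[OF B])
  have ind: "indicator B (x + v) = (indicator ?S x :: real)" for x
    by (auto simp: indicator_def)
  have fm: "B \<inter> X \<in> lmeasurable" if "X \<in> lmeasurable" for X
    using B that by (metis Int_commute fmeasurable_Int_fmeasurable)
  have c: "\<bar>v $ i\<bar> \<le> c" for i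
    unfolding c_def by (rule component_le_norm_cart)
  have tr: "measure lebesgue (?S \<inter> box2 R) = measure lebesgue (B \<inter> (+) v ` box2 R)" for R
  proof -
    have "?S \<inter> box2 R = (\<lambda>x. x - v) ` (B \<inter> (+) v ` box2 R)"
      by (auto simp: image_iff Bex_def algebra_simps)
    then show ?thesis
      by (simp add: measure_translation_subtract)
  qed
  \<comment> \<open>The square and its translate both lie between \<open>box2 (R - c)\<close> and
    \<open>box2 (R + c)\<close>, whose areas differ by 4 * (R + c)^2 - 4 * (R - c)^2 = 16 * c *
    R.\<close>
  have bound: "\<bar>measure lebesgue (?S \<inter> box2 R) - measure lebesgue (B \<inter> box2 R)\<bar> \<le> 16 * c * R"
    if R: "R \<ge> c" for R
  proof -
    have c0: "c \<ge> 0" by (simp add: c_def)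
    have mono: "box2 (R - c) \<subseteq> box2 R" "box2 R \<subseteq> box2 (R + c)"
      using c0 by (auto simp: box2_mono)
    have abs_le: "\<bar>x $ i + y\<bar> \<le> S + c" if "x \<in> box2 S" "\<bar>y\<bar> \<le> c" for x S i y
      using that abs_triangle_ineq[of "x $ i" y] unfolding mem_box2 by (smt (verit))
    have tr_sub: "(+) v ` box2 R \<subseteq> box2 (R + c)"
      using abs_le[OF _ c] by (auto simp: mem_box2[of "_ + _"] add.commute)
    have sub_tr: "box2 (R - c) \<subseteq> (+) v ` box2 R"
    proof
      fix x assume "x \<in> box2 (R - c)"
      then have "x - v \<in> box2 R"
        using abs_le[of x "R - c" "- (v $ _)"] c by (auto simp: mem_box2)
      then show "x \<in> (+) v ` box2 R"
        by (force simp: image_iff)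
    qed
    have trm: "(+) v ` box2 R \<in> lmeasurable"
      by (simp add: measurable_translation)
    have le: "measure lebesgue (B \<inter> X) \<le> measure lebesgue (B \<inter> Y)"
      if "X \<subseteq> Y" "X \<in> lmeasurable" "Y \<in> lmeasurable" for X Y
      using that by (intro measure_mono_fmeasurable) (auto intro: fm fmeasurableD)
    have "measure lebesgue (B \<inter> box2 (R + c)) \<le>
        measure lebesgue (B \<inter> box2 (R - c)) + measure lebesgue (box2 (R + c) - box2 (R - c))"
      by (intro order.trans[OF measure_mono_fmeasurable measure_Un_le])
         (auto intro!: fm fmeasurable.Un fmeasurable.Diff fmeasurableD)
    moreover have "measure lebesgue (box2 (R + c) - box2 (R - c)) = 16 * c * R"
      using R c0 mono
      by (subst measurable_measure_Diff)
         (auto simp: measure_box2 power2_eq_square algebra_simps fmeasurableD)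
    ultimately show ?thesis
      using le[OF mono(1)] le[OF mono(2)] le[OF tr_sub] le[OF sub_tr] trm
      unfolding tr by simp
  qed
  have "((\<lambda>R. box_mean (indicator ?S) R - box_mean (indicator B) R) \<longlongrightarrow> 0) at_top"
  proof (rule Lim_null_comparison)
    show "\<forall>\<^sub>F R in at_top. norm (box_mean (indicator ?S) R - box_mean (indicator B) R) \<le> 4 * c * inverse R"
      using eventually_ge_at_top[of c] eventually_gt_at_top[of 0]
    proof eventually_elim
      case (elim R)
      have "norm (box_mean (indicator ?S) R - box_mean (indicator B) R)
          = \<bar>measure lebesgue (?S \<inter> box2 R) - measure lebesgue (B \<inter> box2 R)\<bar> / (4 * R\<^sup>2)"
        using elim by (simp add: box_mean_indicator B S measure_box2 flip: diff_divide_distrib)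
      also have "\<dots> \<le> 16 * c * R / (4 * R\<^sup>2)"
        using bound[of R] elim by (intro divide_right_mono) auto
      also have "\<dots> = 4 * c * inverse R"
        using elim by (simp add: field_simps power2_eq_square)
      finally show ?case .
    qed
    show "((\<lambda>R. 4 * c * inverse R) \<longlongrightarrow> 0) at_top"
      by (intro tendsto_mult_right_zero tendsto_inverse_0_at_top filterlim_ident)
  qed
  then show ?thesis
    unfolding mean_zero_def ind using set_lebesgue_integral_indicator[OF S] set_lebesgue_integral_indicator[OF B]
    by (auto simp: box_mean_def[abs_def] set_integral_diff diff_divide_distrib)
qed

section \<open>Bounds on the upper density from pointwise inequalities\<close>

lemma upper_density_eq:
  "A \<in> sets lebesgue \<Longrightarrow> upper_density A = Limsup at_top (\<lambda>R. ereal (box_mean (indicator A) R))"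
  by (simp add: upper_density_def box_mean_indicator box2_def)

lemma box_mean_const: "R > 0 \<Longrightarrow> box_mean (\<lambda>x. c) R = c"
  by (simp add: box_mean_def set_lebesgue_integral_def measure_box2)

lemma box_mean_mono:
  assumes "set_integrable lebesgue (box2 R) f" "set_integrable lebesgue (box2 R) g"
    and "\<And>x. f x \<le> g x"
  shows "box_mean f R \<le> box_mean g R"
  unfolding box_mean_def using assms by (intro divide_right_mono set_integral_mono) auto

lemma set_integrable_const_box2: "set_integrable lebesgue (box2 R) (\<lambda>x. c :: real)"
  using lmeasurable_box2[of R] by (simp add: set_integrable_def lmeasurable_iff_integrable)

text \<open>The averages of \<open>g\<close> tend to 0, so averaging the pointwise inequality
  compares the limsup with a genuine limit.\<close>

lemma upper_density_le:
  assumes A: "A \<in> sets lebesgue" and g: "mean_zero g"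
    and le: "\<And>x. 4 * indicator A x \<le> 1 + g x"
  shows "upper_density A \<le> ereal (1/4)"
proof -
  have "\<forall>\<^sub>F R in at_top. box_mean (indicator A) R \<le> (1 + box_mean g R) / 4"
    using eventually_gt_at_top[of 0]
  proof eventually_elim
    case (elim R)
    have ig: "set_integrable lebesgue (box2 R) g"
      using g by (simp add: mean_zero_def)
    have "box_mean (\<lambda>x. 4 * indicator A x) R \<le> box_mean (\<lambda>x. 1 + g x) R"
      by (intro box_mean_mono le set_integral_add set_integrable_const_box2 ig
            set_integrable_mult_right set_lebesgue_integral_indicator A)
    also have "box_mean (\<lambda>x. 1 + g x) R = box_mean (\<lambda>x. 1) R + box_mean g R"
      by (simp add: box_mean_def set_integral_add set_integrable_const_box2 ig add_divide_distrib)
    also have "box_mean (\<lambda>x. 4 * indicator A x) R = 4 * box_mean (indicator A) R"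
      by (simp add: box_mean_def)
    finally show ?case
      using elim by (simp add: box_mean_const)
  qed
  then have "upper_density A \<le> Limsup at_top (\<lambda>R. ereal ((1 + box_mean g R) / 4))"
    unfolding upper_density_eq[OF A] by (intro Limsup_mono) simp
  also have "\<dots> = ereal ((1 + 0) / 4)"
    using g unfolding mean_zero_def
    by (intro lim_imp_Limsup tendsto_ereal tendsto_intros) auto
  finally show ?thesis by simp
qed

lemma upper_density_ge:
  assumes A: "A \<in> sets lebesgue" and g: "mean_zero g"
    and le: "\<And>x. 1 \<le> 4 * indicator A x + g x"
  shows "upper_density A \<ge> ereal (1/4)"
proof -
  have "\<forall>\<^sub>F R in at_top. box_mean (indicator A) R \<ge> (1 - box_mean g R) / 4"
    using eventually_gt_at_top[of 0]
  proof eventually_elim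
    case (elim R)
    have ig: "set_integrable lebesgue (box2 R) g"
      using g by (simp add: mean_zero_def)
    have iA: "set_integrable lebesgue (box2 R) (\<lambda>x. 4 * indicator A x :: real)"
      by (intro set_integrable_mult_right set_lebesgue_integral_indicator A)
    have "box_mean (\<lambda>x. 1) R \<le> box_mean (\<lambda>x. 4 * indicator A x + g x) R"
      by (intro box_mean_mono le set_integral_add set_integrable_const_box2 ig iA)
    also have "\<dots> = box_mean (\<lambda>x. 4 * indicator A x) R + box_mean g R"
      using iA ig by (simp add: box_mean_def set_integral_add add_divide_distrib)
    also have "box_mean (\<lambda>x. 4 * indicator A x) R = 4 * box_mean (indicator A) R"
      by (simp add: box_mean_def)
    finally show ?case
      using elim by (simp add: box_mean_const)
  qed
  then have "Limsup at_top (\<lambda>R. ereal ((1 - box_mean g R) / 4)) \<le> upper_density A"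
    unfolding upper_density_eq[OF A] by (intro Limsup_mono) simp
  moreover have "Limsup at_top (\<lambda>R. ereal ((1 - box_mean g R) / 4)) = ereal ((1 - 0) / 4)"
    using g unfolding mean_zero_def
    by (intro lim_imp_Limsup tendsto_ereal tendsto_intros) auto
  ultimately show ?thesis by simp
qed

section \<open>Two local inequalities\<close>

text \<open>The points of \<open>A\<close> adjacent to \<open>z \<notin> A\<close> are at most two, and if there are two, they are some
  \<open>z + e\<close> and \<open>z - e'\<close> with \<open>e \<noteq> e'\<close>.\<close>

lemma neighbour_count_le:
  fixes a b c :: "real^2"
  assumes nd: "\<And>x y. x \<in> A \<Longrightarrow> y \<in> A \<Longrightarrow> x - y \<notin> {2 *\<^sub>R a, 2 *\<^sub>R b, 2 *\<^sub>R c, a - b, b - c, c - a}"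
  defines "F \<equiv> (indicator A :: _ \<Rightarrow> real)"
  shows "F z + F (z+a) + F (z+b) + F (z+c) + F (z-a) + F (z-b) + F (z-c) 
   - F z * (F (z+a) + F (z+b) + F (z+c) + F (z-a) + F (z-b) + F (z-c))
   - (1 - F z) * (F (z+a) * (F (z-b) + F (z-c)) + F (z+b) * (F (z-a) + F (z-c)) + F (z+c) * (F (z-a) + F (z-b))) \<le> 1"
proof -
  have nd': "False" if "x \<in> A" "y \<in> A" "x - y = d" "d \<in> {2 *\<^sub>R a, 2 *\<^sub>R b, 2 *\<^sub>R c, a - b, b - c, c - a}" for x y d
    using nd that by blast
  \<comment> \<open>Opposite neighbours differ by twice a generator, neighbours of equal sign by a
    difference of two generators. Hence for z outside A at most one z + e and one z - e' remain,
    with e and e' distinct, and the last product subtracts 1 for exactly such a pair. For z in A the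
    left-hand side equals 1.\<close>
  have "\<not> (z + a \<in> A \<and> z - a \<in> A)" using nd'[of "z+a" "z-a"] by (auto simp: scaleR_2)
  moreover have "\<not> (z + b \<in> A \<and> z - b \<in> A)" using nd'[of "z+b" "z-b"] by (auto simp: scaleR_2)
  moreover have "\<not> (z + c \<in> A \<and> z - c \<in> A)" using nd'[of "z+c" "z-c"] by (auto simp: scaleR_2)
  moreover have "\<not> (z + a \<in> A \<and> z + b \<in> A)" using nd'[of "z+a" "z+b"] by auto
  moreover have "\<not> (z + b \<in> A \<and> z + c \<in> A)" using nd'[of "z+b" "z+c"] by auto
  moreover have "\<not> (z + c \<in> A \<and> z + a \<in> A)" using nd'[of "z+c" "z+a"] by auto
  moreover have "\<not> (z - a \<in> A \<and> z - b \<in> A)" using nd'[of "z-b" "z-a"] by auto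
  moreover have "\<not> (z - b \<in> A \<and> z - c \<in> A)" using nd'[of "z-c" "z-b"] by auto
  moreover have "\<not> (z - c \<in> A \<and> z - a \<in> A)" using nd'[of "z-a" "z-c"] by auto
  ultimately show ?thesis
    unfolding F_def indicator_def
    by (cases "z + a \<in> A"; cases "z + b \<in> A"; cases "z + c \<in> A"; simp)
qed

text \<open>The discharging step: the left-hand side without its last two lines is at most 3, except that it is
  4 when \<open>z\<close>, \<open>z + a\<close> and \<open>z + b + c\<close> (or a cyclic variant) lie in \<open>A\<close>. Such a \<open>z\<close> sends one unit to
  \<open>z + a\<close>, which has slack because none of \<open>z + 2a\<close>, \<open>z + a + b\<close>, \<open>z + a + c\<close> lies in \<open>A\<close>.\<close>

lemma upper_neighbour_count_le:
  fixes a b c :: "real^2"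
  assumes nd: "\<And>x y. x \<in> A \<Longrightarrow> y \<in> A \<Longrightarrow> x - y \<notin> {2 *\<^sub>R a, 2 *\<^sub>R b, 2 *\<^sub>R c, a - b, b - c, c - a}"
  defines "F \<equiv> (indicator A :: _ \<Rightarrow> real)"
  shows "2 * F z * (F (z+a) + F (z+b) + F (z+c)) + 2 * F z * (F (z+a+b) + F (z+b+c) + F (z+c+a))
    - F z * (F (z+a+b) * (F (z+a) + F (z+b)) + F (z+b+c) * (F (z+b) + F (z+c)) + F (z+c+a) * (F (z+c) + F (z+a)))
    - F z * (F (z+a) * F (z+b+c) + F (z+b) * F (z+c+a) + F (z+c) * F (z+a+b))
    + F z * (F (z-a) * F (z-a+b+c) + F (z-b) * F (z-b+c+a) + F (z-c) * F (z-c+a+b)) \<le> 3 * F z"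
proof (cases "z \<in> A")
  case False
  then show ?thesis by (simp add: F_def)
next
  case True
  have nd': "False" if "x \<in> A" "y \<in> A" "x - y = d" "d \<in> {2 *\<^sub>R a, 2 *\<^sub>R b, 2 *\<^sub>R c, a - b, b - c, c - a}" for x y d
    using nd that by blast
  have n1: "\<not> (z + a \<in> A \<and> z + b \<in> A)" using nd'[of "z+a" "z+b"] by auto
  have n2: "\<not> (z + b \<in> A \<and> z + c \<in> A)" using nd'[of "z+b" "z+c"] by auto
  have n3: "\<not> (z + c \<in> A \<and> z + a \<in> A)" using nd'[of "z+c" "z+a"] by auto
  have m1: "\<not> (z - a \<in> A \<and> z - b \<in> A)" using nd'[of "z-b" "z-a"] by auto
  have m2: "\<not> (z - b \<in> A \<and> z - c \<in> A)" using nd'[of "z-c" "z-b"] by auto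
  have m3: "\<not> (z - c \<in> A \<and> z - a \<in> A)" using nd'[of "z-a" "z-c"] by auto
  have p1: "\<not> (z + a + b \<in> A \<and> z + b + c \<in> A)" using nd'[of "z+c+b" "z+a+b"] by (auto simp: ac_simps)
  have p2: "\<not> (z + b + c \<in> A \<and> z + c + a \<in> A)" using nd'[of "z+a+c" "z+b+c"] by (auto simp: ac_simps)
  have p3: "\<not> (z + c + a \<in> A \<and> z + a + b \<in> A)" using nd'[of "z+b+a" "z+c+a"] by (auto simp: ac_simps)
  \<comment> \<open>If z receives a unit from z - a, then z has no upper neighbour z + a, z + b, z +
    c in A; \<open>d2\<close> and \<open>d3\<close> are the cyclic variants.\<close>
  have d1: "\<not> (z - a \<in> A \<and> z - a + b + c \<in> A \<and> (z + a \<in> A \<or> z + b \<in> A \<or> z + c \<in> A))"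
    using nd'[of "z+a" "z-a" "2 *\<^sub>R a"] nd'[of "z-a+b+c" "z+b" "c-a"] nd'[of "z+c" "z-a+b+c" "a-b"] by (auto simp: scaleR_2 algebra_simps)
  have d2: "\<not> (z - b \<in> A \<and> z - b + c + a \<in> A \<and> (z + a \<in> A \<or> z + b \<in> A \<or> z + c \<in> A))"
    using nd'[of "z+b" "z-b" "2 *\<^sub>R b"] nd'[of "z-b+c+a" "z+c" "a-b"] nd'[of "z+a" "z-b+c+a" "b-c"] by (auto simp: scaleR_2 algebra_simps)
  have d3: "\<not> (z - c \<in> A \<and> z - c + a + b \<in> A \<and> (z + a \<in> A \<or> z + b \<in> A \<or> z + c \<in> A))"
    using nd'[of "z+c" "z-c" "2 *\<^sub>R c"] nd'[of "z-c+a+b" "z+a" "b-c"] nd'[of "z+b" "z-c+a+b" "c-a"] by (auto simp: scaleR_2 algebra_simps)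
  \<comment> \<open>With an upper neighbour in A nothing is received, and the sum is at most 2 + 2 -
    1. Without one, the second-level points give at most 2, and at most one unit arrives because the
    lower neighbours exclude each other.\<close>
  consider "z + a \<in> A" | "z + b \<in> A" | "z + c \<in> A" | "z + a \<notin> A" "z + b \<notin> A" "z + c \<notin> A"
    by blast
  then show ?thesis
  proof cases
    case 4
    then show ?thesis
      using True m1 m2 m3 p1 p2 p3 unfolding F_def indicator_def
      by (cases "z - a \<in> A"; cases "z - b \<in> A"; cases "z - c \<in> A"; cases "z+a+b \<in> A"; cases "z+b+c \<in> A"; simp)
  qed (use True n1 n2 n3 p1 p2 p3 d1 d2 d3 in \<open>unfold F_def indicator_def; cases "z+a+b \<in> A"; cases "z+b+c \<in> A"; simp\<close>)+
qed

text \<open>In the mean, the products in the two local inequalities cancel when these are added; the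
  single values leave 7 - 3 = 4 times the density on the left and 1 on the right.\<close>

lemma upper_density_avoiding_le:
  fixes a b c :: "real^2"
  assumes A: "A \<in> sets lebesgue"
    and nd: "\<And>x y. x \<in> A \<Longrightarrow> y \<in> A \<Longrightarrow> x - y \<notin> {2 *\<^sub>R a, 2 *\<^sub>R b, 2 *\<^sub>R c, a - b, b - c, c - a}"
  shows "upper_density A \<le> ereal (1/4)"
proof -
  define F where "F = (indicator A :: _ \<Rightarrow> real)"
  \<comment> \<open>\<open>F\<close> is idempotent, so \<open>T 0 0 = F\<close> and \<open>T 0 q\<close> is a product of two factors.\<close>
  define T where "T p q x = F x * F (x + p) * F (x + q)" for p q x
  define D where "D p q d x = T p q (x - d) - T p q x" for p q d x
  have D: "mean_zero (D p q d)" for p q d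
  proof -
    define B where "B = A \<inter> {x. x + p \<in> A} \<inter> {x. x + q \<in> A}"
    have "B \<in> sets lebesgue"
      unfolding B_def by (intro sets.Int A sets_lebesgue_shift)
    moreover have "D p q d = (\<lambda>x. indicator B (x + (- d)) - indicator B x)"
      by (auto simp: D_def T_def F_def B_def indicator_def)
    ultimately show ?thesis
      using mean_zero_shift by metis
  qed
  \<comment> \<open>Each \<open>D\<close> moves one product to a common base point. Line by line
    these are: single values, pairs at distance e, pairs at distance e + e' (occurring as z - e, z +
    e'), triples z - e, z, z + e', and the units sent from z to z + e.\<close>
  define g where "g x =
      - (D 0 0 a x + D 0 0 b x + D 0 0 c x + D 0 0 (-a) x + D 0 0 (-b) x + D 0 0 (-c) x)
      + (D 0 a a x + D 0 b b x + D 0 c c x)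
      + (D 0 (a+b) b x + D 0 (a+b) a x + D 0 (b+c) c x + D 0 (b+c) b x + D 0 (c+a) a x + D 0 (c+a) c x)
      - (D b (a+b) b x + D a (a+b) a x + D c (b+c) c x + D b (b+c) b x + D a (c+a) a x + D c (c+a) c x)
      - (D a (b+c) a x + D b (c+a) b x + D c (a+b) c x)" for x
  have g: "mean_zero g"
    unfolding g_def by (intro mean_zero_add mean_zero_diff mean_zero_minus D)
  have FF: "F x * F x = F x" for x
    by (simp add: F_def indicator_def)
  have FF': "F x * (F x * y) = F x * y" for x y
    by (simp add: F_def indicator_def)
  have "4 * F z \<le> 1 + g z" for z
    using neighbour_count_le[of A a b c z, OF nd, folded F_def] upper_neighbour_count_le[of A a b c z, OF nd, folded F_def]
    unfolding g_def D_def T_def 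
    by (simp add: FF FF' algebra_simps)
  then show ?thesis
    using upper_density_le[OF A g] by (simp add: F_def)
qed

section \<open>Planar lattices and their Voronoi norms\<close>

definition det2 :: "real^2 \<Rightarrow> real^2 \<Rightarrow> real" where
  "det2 u v = u$1 * v$2 - u$2 * v$1"

lemma inner2: "inner (x::real^2) y = x$1 * y$1 + x$2 * y$2"
  by (simp add: inner_vec_def UNIV_2)

lemma vec2_eq_iff: "(x::real^2) = y \<longleftrightarrow> x$1 = y$1 \<and> x$2 = y$2"
  by (simp add: vec_eq_iff forall_2)

lemma det2_neq_0:
  assumes "independent {u, v}" "u \<noteq> v"
  shows "det2 u v \<noteq> 0"
proof
  assume 0: "det2 u v = 0"
  have "v \<noteq> 0" using assms(1) dependent_zero by blast
  then have v: "inner v v \<noteq> 0" by simp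
  have "u = (inner u v / inner v v) *\<^sub>R v"
    using 0 v unfolding vec2_eq_iff inner2 det2_def by (simp add: field_simps)
  then have "u \<in> span {v}"
    by (metis insertI1 span_base span_mul)
  then show False
    using assms by (metis independent_insert singletonD)
qed

lemma lattice_genI [intro]: "of_int m *\<^sub>R u + of_int n *\<^sub>R v \<in> lattice_gen u v"
  by (auto simp: lattice_gen_def)

lemma lattice_gen_gens: "u \<in> lattice_gen u v" "v \<in> lattice_gen u v" "0 \<in> lattice_gen u v"
  using lattice_genI[of 1 u 0 v] lattice_genI[of 0 u 1 v] lattice_genI[of 0 u 0 v] by auto

lemma lattice_gen_diff:
  assumes "x \<in> lattice_gen u v" "y \<in> lattice_gen u v"
  shows "x - y \<in> lattice_gen u v"
proof -
  obtain m n m' n' where "x = of_int m *\<^sub>R u + of_int n *\<^sub>R v" "y = of_int m' *\<^sub>R u + of_int n' *\<^sub>R v"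
    using assms by (auto simp: lattice_gen_def)
  then have "x - y = of_int (m - m') *\<^sub>R u + of_int (n - n') *\<^sub>R v"
    by (simp add: algebra_simps)
  then show ?thesis by (simp only: lattice_genI)
qed

lemma lattice_gen_minus: "x \<in> lattice_gen u v \<Longrightarrow> - x \<in> lattice_gen u v"
  using lattice_gen_diff[of 0 u v x] lattice_gen_gens by simp

lemma lattice_gen_add: "x \<in> lattice_gen u v \<Longrightarrow> y \<in> lattice_gen u v \<Longrightarrow> x + y \<in> lattice_gen u v"
  using lattice_gen_diff[of x u v "- y"] lattice_gen_minus by simp

lemma lattice_gen_neg: "lattice_gen (- u) v = lattice_gen u v"
proof -
  have "of_int m *\<^sub>R - u + of_int n *\<^sub>R v = of_int (- m) *\<^sub>R u + of_int n *\<^sub>R v" for m n by simp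
  moreover have "of_int m *\<^sub>R u + of_int n *\<^sub>R v = of_int (- m) *\<^sub>R - u + of_int n *\<^sub>R v" for m n by simp
  ultimately show ?thesis
    unfolding lattice_gen_def by blast
qed

lemma lattice_gen_swap: "lattice_gen v u = lattice_gen u v"
  unfolding lattice_gen_def by (metis add.commute)

lemma lattice_gen_third: "lattice_gen u (- u - v) = lattice_gen u v"
proof -
  have "of_int m *\<^sub>R u + of_int n *\<^sub>R (- u - v) = of_int (m - n) *\<^sub>R u + of_int (- n) *\<^sub>R v" for m n
    by (simp add: algebra_simps)
  moreover have "of_int m *\<^sub>R u + of_int n *\<^sub>R v = of_int (m - n) *\<^sub>R u + of_int (- n) *\<^sub>R (- u - v)" for m n
    by (simp add: algebra_simps)
  ultimately show ?thesis
    unfolding lattice_gen_def by blast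
qed

text \<open>By Cramer's rule the coordinates of \<open>x\<close> are
  \<open>det2 x v / det2 u v\<close> and \<open>det2 u x / det2 u v\<close>, so a bound on the norm
  bounds these integers.\<close>

lemma finite_lattice_ball:
  assumes d: "det2 u v \<noteq> 0"
  shows "finite {x \<in> lattice_gen u v. norm x \<le> r}"
proof -
  define K where "K = \<lceil>2 * r * (norm u + norm v) / \<bar>det2 u v\<bar>\<rceil>"
  let ?f = "\<lambda>(m, n). of_int m *\<^sub>R u + of_int n *\<^sub>R v"
  have det_le: "\<bar>det2 x y\<bar> \<le> 2 * norm x * norm y" for x y
  proof -
    have "\<bar>x$1 * y$2\<bar> \<le> norm x * norm y" "\<bar>x$2 * y$1\<bar> \<le> norm x * norm y"
      unfolding abs_mult by (intro mult_mono component_le_norm_cart; simp)+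
    then show ?thesis unfolding det2_def by linarith
  qed
  have "{x \<in> lattice_gen u v. norm x \<le> r} \<subseteq> ?f ` ({-K..K} \<times> {-K..K})"
  proof
    fix x assume "x \<in> {x \<in> lattice_gen u v. norm x \<le> r}"
    then obtain m n where x: "x = of_int m *\<^sub>R u + of_int n *\<^sub>R v" and r: "norm x \<le> r"
      by (auto simp: lattice_gen_def)
    have *: "\<bar>k\<bar> \<le> K" if "det2 y z = of_int k * det2 u v" "norm y * norm z \<le> r * (norm u + norm v)" for k y z
    proof -
      have "\<bar>of_int k\<bar> * \<bar>det2 u v\<bar> \<le> 2 * r * (norm u + norm v)"
        using that det_le[of y z] by (simp add: abs_mult)
      then have "\<bar>of_int k\<bar> \<le> 2 * r * (norm u + norm v) / \<bar>det2 u v\<bar>"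
        using d by (simp add: field_simps)
      then show ?thesis
        unfolding K_def by linarith
    qed
    have "r \<ge> 0" using r norm_ge_zero[of x] by linarith
    then have le: "norm x * norm v \<le> r * (norm u + norm v)" "norm u * norm x \<le> r * (norm u + norm v)"
      using r mult_mono[of "norm x" r "norm v" "norm u + norm v"] mult_mono[of "norm x" r "norm u" "norm u + norm v"]
      by (auto simp: mult.commute)
    have "det2 x v = of_int m * det2 u v" "det2 u x = of_int n * det2 u v"
      by (simp_all add: x det2_def algebra_simps)
    then have "\<bar>m\<bar> \<le> K" "\<bar>n\<bar> \<le> K"
      using * le by blast+
    then show "x \<in> ?f ` ({-K..K} \<times> {-K..K})"
      unfolding x by (intro image_eqI[of _ _ "(m, n)"]) (auto simp: abs_le_iff)
  qed
  then show ?thesis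
    by (rule finite_subset) auto
qed

lemma countable_lattice_gen: "countable (lattice_gen u v)"
proof -
  have "lattice_gen u v = (\<lambda>(m, n). of_int m *\<^sub>R u + of_int n *\<^sub>R v) ` UNIV"
    by (auto simp: lattice_gen_def)
  then show ?thesis by simp
qed

text \<open>If \<open>inner u v > 0\<close>, then passing from \<open>u, v\<close> to \<open>- u, v\<close> decreases
  \<open>|u|\<^sup>2 + |v|\<^sup>2 + |u + v|\<^sup>2\<close>, so a minimiser of this sum over all bases is obtuse.\<close>

lemma obtuse_basis_exists:
  assumes d: "det2 b1 b2 \<noteq> 0"
  obtains u v where "det2 u v \<noteq> 0" "lattice_gen u v = lattice_gen b1 b2"
    "inner u v \<le> 0" "inner u (- u - v) \<le> 0" "inner v (- u - v) \<le> 0"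
proof -
  define f where "f = (\<lambda>(u, v :: real^2). inner u u + inner v v + inner (u + v) (u + v))"
  define G where "G = {(u, v). det2 u v \<noteq> 0 \<and> lattice_gen u v = lattice_gen b1 b2}"
  define r where "r = sqrt (f (b1, b2))"
  define X where "X = {x \<in> lattice_gen b1 b2. norm x \<le> r}"
  \<comment> \<open>Cutting off at the value of the given basis leaves finitely many bases, as both
    members then lie in a ball; a minimiser over \<open>S\<close> is one over all of
    \<open>G\<close>.\<close>
  define S where "S = {p \<in> G. f p \<le> f (b1, b2)}"
  have norm_le: "norm x \<le> r \<and> norm y \<le> r" if "f (x, y) \<le> f (b1, b2)" for x y
  proof -
    have "inner x x \<le> f (b1, b2)" "inner y y \<le> f (b1, b2)"
      using that inner_ge_zero[of x] inner_ge_zero[of y] inner_ge_zero[of "x + y"]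
      unfolding f_def prod.case by linarith+
    then show ?thesis
      unfolding r_def by (simp add: norm_eq_sqrt_inner)
  qed
  have "S \<subseteq> X \<times> X"
    unfolding S_def X_def G_def using norm_le lattice_gen_gens by fast
  moreover have "finite X"
    unfolding X_def by (rule finite_lattice_ball[OF d])
  ultimately have "finite S"
    using finite_subset by blast
  moreover have "(b1, b2) \<in> S"
    using d by (simp add: S_def G_def)
  ultimately have S: "arg_min_on f S \<in> S" "\<not> (\<exists>p\<in>S. f p < f (arg_min_on f S))"
    using arg_min_if_finite[of S f] by blast+
  obtain u v where uv: "arg_min_on f S = (u, v)"
    by fastforce
  have G: "(u, v) \<in> G" and fle: "f (u, v) \<le> f (b1, b2)"
    using S(1) unfolding uv by (auto simp: S_def)
  have min: "f (u, v) \<le> f p" if "p \<in> G" for p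
  proof (cases "p \<in> S")
    case True
    then show ?thesis using S(2) by (force simp: uv not_less)
  next
    case False
    then show ?thesis using fle that by (simp add: S_def)
  qed
  have G1: "(- x, y) \<in> G" if "(x, y) \<in> G" for x y
    using that by (auto simp: G_def lattice_gen_neg det2_def)
  have G2: "(x, - x - y) \<in> G" if "(x, y) \<in> G" for x y
    using that by (auto simp: G_def lattice_gen_third det2_def algebra_simps)
  have G3: "(y, x) \<in> G" if "(x, y) \<in> G" for x y
    using that by (auto simp: G_def lattice_gen_swap[of y x] det2_def algebra_simps)
  show ?thesis
  proof
    show "det2 u v \<noteq> 0" "lattice_gen u v = lattice_gen b1 b2"
      using G by (auto simp: G_def)
    \<comment> \<open>\<open>f\<close> is symmetric in the squared lengths of \<open>u\<close>,
      \<open>v\<close>, \<open>- u - v\<close>, hence unchanged by \<open>G2\<close> and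
      \<open>G3\<close>, while passing from \<open>(x, y)\<close> to \<open>(- x, y)\<close> changes
      it by \<open>- 4 * inner x y\<close>. Minimality gives one sign for each pair.\<close>
    show "inner u v \<le> 0"
      using min[OF G1[OF G]] by (simp add: f_def inner_simps inner_commute)
    show "inner u (- u - v) \<le> 0"
      using min[OF G1[OF G2[OF G]]] by (simp add: f_def inner_simps inner_commute)
    show "inner v (- u - v) \<le> 0"
      using min[OF G1[OF G2[OF G3[OF G]]]] by (simp add: f_def inner_simps inner_commute)
  qed
qed

lemma ex_closest_lattice_point:
  assumes d: "det2 u v \<noteq> 0"
  obtains p where "p \<in> lattice_gen u v" "\<And>q. q \<in> lattice_gen u v \<Longrightarrow> norm (x - p) \<le> norm (x - q)"
proof -
  \<comment> \<open>A point of norm above \<open>2 * norm x\<close> is at least as far from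
    \<open>x\<close> as the lattice point 0, so the search may be confined to this ball.\<close>
  define S where "S = {p \<in> lattice_gen u v. norm p \<le> 2 * norm x}"
  have S: "finite S" "0 \<in> S"
    unfolding S_def using finite_lattice_ball[OF d] lattice_gen_gens by auto
  define p where "p = arg_min_on (\<lambda>p. norm (x - p)) S"
  have p: "p \<in> S" "\<And>q. q \<in> S \<Longrightarrow> norm (x - p) \<le> norm (x - q)"
    unfolding p_def using arg_min_if_finite[of S "\<lambda>p. norm (x - p)"] S by force+
  show ?thesis
  proof
    show "p \<in> lattice_gen u v" using p(1) by (simp add: S_def)
    fix q assume q: "q \<in> lattice_gen u v"
    show "norm (x - p) \<le> norm (x - q)"
    proof (cases "q \<in> S")
      case False
      then have "norm q > 2 * norm x" using q by (simp add: S_def)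
      then have "norm (x - q) \<ge> norm x"
        using norm_triangle_ineq2[of q x] by (simp add: norm_minus_commute)
      then show ?thesis using p(2)[OF S(2)] by simp
    qed (rule p(2))
  qed
qed

section \<open>The Voronoi region as an intersection of half-planes, its gauge and its
  vertices\<close>

lemma voronoi_iff: "z \<in> voronoi L \<longleftrightarrow> (\<forall>x\<in>L. 2 * inner z x \<le> inner x x)"
  by (auto simp: voronoi_def inner_simps inner_commute)

lemma voronoi_image_iff:
  "t > 0 \<Longrightarrow> x \<in> (\<lambda>r. t *\<^sub>R r) ` voronoi L \<longleftrightarrow> (\<forall>y\<in>L. 2 * inner x y \<le> t * inner y y)"
proof -
  assume t: "t > 0"
  have "x \<in> (\<lambda>r. t *\<^sub>R r) ` voronoi L \<longleftrightarrow> (1/t) *\<^sub>R x \<in> voronoi L"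
    using t by (auto simp: image_iff intro!: bexI[of _ "(1/t) *\<^sub>R x"])
  also have "\<dots> \<longleftrightarrow> (\<forall>y\<in>L. 2 * inner x y \<le> t * inner y y)"
    using t by (simp add: voronoi_iff field_simps)
  finally show ?thesis .
qed

lemma gauge_norm_voronoi_le:
  "t > 0 \<Longrightarrow> (\<And>y. y \<in> L \<Longrightarrow> 2 * inner x y \<le> t * inner y y) \<Longrightarrow> gauge_norm (voronoi L) x \<le> t"
  unfolding gauge_norm_def
  by (rule cInf_lower) (auto simp: voronoi_image_iff intro: bdd_belowI[of _ 0])

text \<open>The first two assumptions make the set in the definition of the gauge nonempty, so that its infimum is
  meaningful.\<close>

lemma gauge_norm_voronoi_ge:
  assumes "t > 0" "\<And>y. y \<in> L \<Longrightarrow> 2 * inner x y \<le> t * inner y y"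
    and y: "y \<in> L" "y \<noteq> 0"
  shows "gauge_norm (voronoi L) x \<ge> 2 * inner x y / inner y y"
  unfolding gauge_norm_def
proof (rule cInf_greatest)
  show "{t. 0 \<le> t \<and> x \<in> (\<lambda>r. t *\<^sub>R r) ` voronoi L} \<noteq> {}"
    using assms by (auto simp: voronoi_image_iff intro!: exI[of _ t])
  fix s assume "s \<in> {t. 0 \<le> t \<and> x \<in> (\<lambda>r. t *\<^sub>R r) ` voronoi L}"
  then obtain r where s: "s \<ge> 0" "x = s *\<^sub>R r" "r \<in> voronoi L" by auto
  then have "s * (2 * inner r y) \<le> s * inner y y"
    using y by (intro mult_left_mono) (auto simp: voronoi_iff)
  then show "2 * inner x y / inner y y \<le> s"
    using s y by (simp add: field_simps)
qed

text \<open>Membership in the region bounds the gauge by 1 from above, and lying on the bisector of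
  0 and \<open>y\<close> bounds it by 1 from below.\<close>

lemma gauge_norm_voronoi_eq_1:
  assumes "\<And>y. y \<in> L \<Longrightarrow> 2 * inner x y \<le> inner y y" "y \<in> L" "y \<noteq> 0" "2 * inner x y = inner y y"
  shows "gauge_norm (voronoi L) x = 1"
  using gauge_norm_voronoi_le[of 1 L x] gauge_norm_voronoi_ge[of 1 L x y] assms by fastforce

text \<open>Cramer's rule; it produces a circumcentre from its two bisector equations.\<close>

lemma ex_inner_eq:
  assumes "det2 u v \<noteq> 0"
  obtains z where "inner z u = \<alpha>" "inner z v = \<beta>"
proof
  let ?z = "(\<chi> i. if i = 1 then (\<alpha> * v$2 - \<beta> * u$2) / det2 u v else (\<beta> * u$1 - \<alpha> * v$1) / det2 u v) :: real^2"
  have "inner ?z u = ((\<alpha> * v$2 - \<beta> * u$2) * u$1 + (\<beta> * u$1 - \<alpha> * v$1) * u$2) / det2 u v"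
    by (simp add: inner2 add_divide_distrib)
  also have "(\<alpha> * v$2 - \<beta> * u$2) * u$1 + (\<beta> * u$1 - \<alpha> * v$1) * u$2 = \<alpha> * det2 u v"
    by (simp add: det2_def algebra_simps)
  finally show "inner ?z u = \<alpha>" using assms by simp
  have "inner ?z v = ((\<alpha> * v$2 - \<beta> * u$2) * v$1 + (\<beta> * u$1 - \<alpha> * v$1) * v$2) / det2 u v"
    by (simp add: inner2 add_divide_distrib)
  also have "(\<alpha> * v$2 - \<beta> * u$2) * v$1 + (\<beta> * u$1 - \<alpha> * v$1) * v$2 = \<beta> * det2 u v"
    by (simp add: det2_def algebra_simps)
  finally show "inner ?z v = \<beta>" using assms by simp
qed

text \<open>Here \<open>z\<close> is the circumcentre of the Delaunay triangle \<open>0\<close>, \<open>u\<close>, \<open>u + v\<close>.\<close>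

lemma voronoi_vertex:
  assumes "u + v + w = 0" "inner u v \<le> 0" "inner u w \<le> 0" "inner v w \<le> 0"
    and z: "2 * inner z u = inner u u" "2 * inner z w = - inner w w"
    and x: "x \<in> lattice_gen u v"
  shows "2 * inner z x \<le> inner x x"
proof -
  obtain m n where x: "x = of_int m *\<^sub>R u + of_int n *\<^sub>R v"
    using x by (auto simp: lattice_gen_def)
  have w: "w = - u - v"
    using assms(1) by (metis add.commute add_diff_cancel_left' diff_0 diff_diff_eq)
  have zv: "2 * inner z v = inner w w - inner u u"
    using z unfolding w by (simp add: inner_simps)
  \<comment> \<open>Integrality enters here: no integer lies strictly between 0 and 1.\<close>
  have sq: "of_int k * of_int k - of_int k \<ge> (0::real)" for k :: int
  proof -
    have "k * k - k \<ge> 0"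
      by (cases "k \<ge> 1") (auto simp: mult_le_cancel_right1 mult_le_0_iff intro: order.trans[of k 0])
    then show ?thesis
      by (metis of_int_0_le_iff of_int_diff of_int_mult)
  qed
  have "inner x x - 2 * inner z x = inner x x - of_int m * (2 * inner z u) - of_int n * (2 * inner z v)"
    by (simp add: x inner_simps)
  \<comment> \<open>Selling's formula writes \<open>inner x x\<close> as the combination of the
    squares of m - n, m and n with coefficients \<open>- inner u v\<close>,
    \<open>- inner u w\<close>, \<open>- inner v w\<close>. For this \<open>z\<close> the linear
    part has the same coefficients, so each square k * k becomes k * k - k.\<close>
  also have "\<dots> = - inner u v * (of_int (m - n) * of_int (m - n) - of_int (m - n))
      + - inner u w * (of_int m * of_int m - of_int m) + - inner v w * (of_int n * of_int n - of_int n)"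
    unfolding z zv by (simp add: w x inner_simps inner_commute algebra_simps)
  also have "\<dots> \<ge> 0"
    using assms by (intro add_nonneg_nonneg mult_nonneg_nonneg sq) auto
  finally show ?thesis by simp
qed

section \<open>The upper bound for an obtuse basis\<close>

lemma upper_density_avoids_voronoi_le:
  assumes d: "det2 u v \<noteq> 0"
    and ob: "inner u v \<le> 0" "inner u (- u - v) \<le> 0" "inner v (- u - v) \<le> 0"
    and A: "A \<in> sets lebesgue" "avoids_one (gauge_norm (voronoi (lattice_gen u v))) A"
  shows "upper_density A \<le> ereal (1/4)"
proof -
  let ?L = "lattice_gen u v"
  define w where "w = - u - v"
  have sum0: "u + v + w = 0" "v + w + u = 0" "w + u + v = 0"
    by (simp_all add: w_def)
  have L: "lattice_gen v w = ?L" "lattice_gen w u = ?L"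
    using lattice_gen_third[of v u] lattice_gen_third[of u v] lattice_gen_swap[of w u] lattice_gen_swap[of v u]
    by (simp_all add: w_def minus_diff_commute[of v u])
  have mem: "u \<in> ?L" "v \<in> ?L" "w \<in> ?L"
    using lattice_gen_gens lattice_gen_gens(1)[of w u] by (auto simp: L)
  have dets: "det2 u w \<noteq> 0" "det2 v u \<noteq> 0" "det2 w v \<noteq> 0"
    using d by (auto simp: det2_def w_def algebra_simps)
  then have ne: "u \<noteq> 0" "v \<noteq> 0" "w \<noteq> 0"
    by (auto simp: det2_def)
  \<comment> \<open>The circumcentres of the triangles 0, u, -w and 0, v, -u and 0, w, -v, cyclic
    images of one another. \<open>z1\<close> and \<open>- z2\<close> both lie on the bisector of 0
    and \<open>u\<close>, so \<open>a - b\<close> below, their midpoint, lies on it too; likewise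
    \<open>b - c\<close> for \<open>v\<close> and \<open>c - a\<close> for \<open>w\<close>.\<close>
  obtain z1 where "inner z1 u = inner u u / 2" "inner z1 w = - inner w w / 2"
    using ex_inner_eq[OF dets(1)] .
  then have z1: "2 * inner z1 u = inner u u" "2 * inner z1 w = - inner w w" by auto
  obtain z2 where "inner z2 v = inner v v / 2" "inner z2 u = - inner u u / 2"
    using ex_inner_eq[OF dets(2)] .
  then have z2: "2 * inner z2 v = inner v v" "2 * inner z2 u = - inner u u" by auto
  obtain z3 where "inner z3 w = inner w w / 2" "inner z3 v = - inner v v / 2"
    using ex_inner_eq[OF dets(3)] .
  then have z3: "2 * inner z3 w = inner w w" "2 * inner z3 v = - inner v v" by auto
  note ob' = ob[folded w_def] 
  have le1: "2 * inner z1 x \<le> inner x x" if "x \<in> ?L" for x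
    using voronoi_vertex[OF sum0(1) _ _ _ z1] that ob' by blast
  have le2: "2 * inner z2 x \<le> inner x x" if "x \<in> ?L" for x
    using voronoi_vertex[OF sum0(2) _ _ _ z2, unfolded L] that ob' by (simp add: inner_commute)
  have le3: "2 * inner z3 x \<le> inner x x" if "x \<in> ?L" for x
    using voronoi_vertex[OF sum0(3) _ _ _ z3, unfolded L] that ob' by (simp add: inner_commute)
  define a b c where "a = (1/2) *\<^sub>R z1" and "b = (1/2) *\<^sub>R z2" and "c = (1/2) *\<^sub>R z3"
  note abc = a_def b_def c_def
  let ?N = "gauge_norm (voronoi ?L)"
  \<comment> \<open>The region is convex and symmetric about 0, so it contains half the difference
    of any two of its points.\<close>
  have half: "2 * inner ((1/2) *\<^sub>R z - (1/2) *\<^sub>R z') x \<le> inner x x"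
    if "x \<in> ?L" "\<And>x. x \<in> ?L \<Longrightarrow> 2 * inner z x \<le> inner x x" "\<And>x. x \<in> ?L \<Longrightarrow> 2 * inner z' x \<le> inner x x" for z z' x
    using that(2)[OF that(1)] that(3)[OF lattice_gen_minus[OF that(1)]]
    by (simp add: inner_simps)
  have "?N (2 *\<^sub>R a) = 1" "?N (2 *\<^sub>R b) = 1" "?N (2 *\<^sub>R c) = 1"
    using gauge_norm_voronoi_eq_1[OF le1 mem(1) ne(1) z1(1)] gauge_norm_voronoi_eq_1[OF le2 mem(2) ne(2) z2(1)]
      gauge_norm_voronoi_eq_1[OF le3 mem(3) ne(3) z3(1)]
    by (simp_all add: abc)
  moreover have "?N (a - b) = 1"
    unfolding abc using z1 z2
    by (intro gauge_norm_voronoi_eq_1[OF half[OF _ le1 le2] mem(1) ne(1)]) (auto simp: inner_simps)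
  moreover have "?N (b - c) = 1"
    unfolding abc using z2 z3
    by (intro gauge_norm_voronoi_eq_1[OF half[OF _ le2 le3] mem(2) ne(2)]) (auto simp: inner_simps)
  moreover have "?N (c - a) = 1"
    unfolding abc using z3 z1
    by (intro gauge_norm_voronoi_eq_1[OF half[OF _ le3 le1] mem(3) ne(3)]) (auto simp: inner_simps)
  ultimately have unit: "?N d = 1" if "d \<in> {2 *\<^sub>R a, 2 *\<^sub>R b, 2 *\<^sub>R c, a - b, b - c, c - a}" for d
    using that by (elim insertE emptyE) simp_all
  have "x - y \<notin> {2 *\<^sub>R a, 2 *\<^sub>R b, 2 *\<^sub>R c, a - b, b - c, c - a}" if "x \<in> A" "y \<in> A" for x y
    using A(2) that unit unfolding avoids_one_def by blast
  then show ?thesis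
    by (rule upper_density_avoiding_le[OF A(1)])
qed

section \<open>The lower bound: a packing of half Voronoi regions\<close>

lemma gauge_radius_exists:
  assumes d: "det2 u v \<noteq> 0" and s: "s > 0"
  obtains t where "t \<ge> s" "\<And>m. m \<in> lattice_gen u v \<Longrightarrow> 2 * inner x m \<le> t * inner m m"
    "t = s \<or> (\<exists>m\<in>lattice_gen u v - {0}. t = 2 * inner x m / inner m m)"
proof -
  \<comment> \<open>By Cauchy-Schwarz only these finitely many vectors can require a factor above
    \<open>s\<close>. The resulting bound is an attained maximum, so strict inequalities for all
    \<open>m\<close> make it strictly smaller than 1 later on.\<close>
  define M where "M = {m \<in> lattice_gen u v. norm m \<le> 2 * norm x / s} - {0}"
  define T where "T = insert s ((\<lambda>m. 2 * inner x m / inner m m) ` M)"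
  have T: "finite T" "T \<noteq> {}"
    unfolding T_def M_def using finite_lattice_ball[OF d] by auto
  have Max: "Max T \<in> T" "\<And>y. y \<in> T \<Longrightarrow> y \<le> Max T"
    using T by auto
  show ?thesis
  proof
    show ge: "Max T \<ge> s" using Max by (simp add: T_def)
    show "Max T = s \<or> (\<exists>m\<in>lattice_gen u v - {0}. Max T = 2 * inner x m / inner m m)"
      using Max(1) unfolding T_def M_def by auto
    fix m assume m: "m \<in> lattice_gen u v"
    consider "m = 0" | "m \<in> M" | "norm m > 2 * norm x / s"
      using m unfolding M_def by force
    then show "2 * inner x m \<le> Max T * inner m m"
    proof cases
      case 2
      then have "2 * inner x m / inner m m \<le> Max T" "m \<noteq> 0"
        using Max(2) by (auto simp: T_def M_def)
      then show ?thesis by (simp add: field_simps)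
    next
      case 3
      have "2 * inner x m \<le> 2 * norm x * norm m"
        using norm_cauchy_schwarz[of x m] by simp
      also have "\<dots> \<le> (s * norm m) * norm m"
        using 3 s by (intro mult_right_mono) (auto simp: field_simps)
      also have "\<dots> \<le> (Max T * norm m) * norm m"
        by (intro mult_right_mono ge) auto
      also have "\<dots> = Max T * inner m m"
        by (simp add: dot_square_norm power2_eq_square)
      finally show ?thesis .
    qed simp
  qed
qed

text \<open>\<open>2 *\<^sub>R (x - l)\<close> is required to lie strictly on the side of 0 of every
  bisector. Strictness rules out differences of norm exactly 1; it would fail at
  \<open>m = 0\<close>, whence the exclusion.\<close>

definition half_voronoi_packing :: "(real^2) set \<Rightarrow> (real^2) set" where
  "half_voronoi_packing L = {x. \<exists>l\<in>L. \<forall>m\<in>L - {0}. 4 * inner (x - l) m < inner m m}"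

lemma half_voronoi_packing_sets:
  assumes "countable L"
  shows "half_voronoi_packing L \<in> sets lebesgue"
proof -
  have "half_voronoi_packing L = (\<Union>l\<in>L. \<Inter>m\<in>L - {0}. {x. 4 * inner (x - l) m < inner m m})"
    by (auto simp: half_voronoi_packing_def)
  moreover have "open {x. 4 * inner (x - l) m < inner m m}" for l m :: "real^2"
    by (intro open_Collect_less continuous_intros)
  then have "{x. 4 * inner (x - l) m < inner m m} \<in> sets lebesgue" for l m :: "real^2"
    by (simp add: borel_open)
  ultimately show ?thesis
    using assms by (auto intro!: sets.countable_UN'' sets.countable_INT'')
qed

lemma half_voronoi_packing_avoids:
  assumes d: "det2 u v \<noteq> 0"
  defines "L \<equiv> lattice_gen u v"
  shows "avoids_one (gauge_norm (voronoi L)) (half_voronoi_packing L)"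
  unfolding avoids_one_def
proof (intro ballI)
  fix x y assume "x \<in> half_voronoi_packing L" "y \<in> half_voronoi_packing L"
  then obtain l l' where l: "l \<in> L" "\<And>m. m \<in> L - {0} \<Longrightarrow> 4 * inner (x - l) m < inner m m"
    and l': "l' \<in> L" "\<And>m. m \<in> L - {0} \<Longrightarrow> 4 * inner (y - l') m < inner m m"
    by (auto simp: half_voronoi_packing_def)
  define n where "n = l - l'"
  have n: "n \<in> L"
    unfolding n_def using l l' by (simp add: L_def lattice_gen_diff)
  \<comment> \<open>A difference of two points of the open half region lies in the open region, by
    symmetry under negation.\<close>
  have lt: "2 * inner (x - y - n) m < inner m m" if "m \<in> L - {0}" for m
  proof -
    have "- m \<in> L - {0}" using that by (simp add: L_def lattice_gen_minus)
    then show ?thesis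
      using l(2)[OF that] l'(2)[of "- m"] by (simp add: n_def inner_simps)
  qed
  show "gauge_norm (voronoi L) (x - y) \<noteq> 1"
  proof (cases "n = 0")
    case True
    \<comment> \<open>Same cell, so the norm is below 1. The floor 1/2 stands for any number
      strictly between 0 and 1.\<close>
    obtain t where t: "t \<ge> 1/2" "\<And>m. m \<in> L \<Longrightarrow> 2 * inner (x - y) m \<le> t * inner m m"
      "t = 1/2 \<or> (\<exists>m\<in>L - {0}. t = 2 * inner (x - y) m / inner m m)"
      using gauge_radius_exists[OF d, of "1/2" "x - y"] unfolding L_def by auto
    have "t < 1"
      using t(3)
    proof
      assume "\<exists>m\<in>L - {0}. t = 2 * inner (x - y) m / inner m m"
      then obtain m where "m \<in> L - {0}" "t = 2 * inner (x - y) m / inner m m" by blast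
      then show ?thesis using lt[of m] True by simp
    qed simp
    moreover have "gauge_norm (voronoi L) (x - y) \<le> t"
      using t by (intro gauge_norm_voronoi_le) auto
    ultimately show ?thesis by simp
  next
    case False
    obtain t where t: "t \<ge> 1" "\<And>m. m \<in> L \<Longrightarrow> 2 * inner (x - y) m \<le> t * inner m m"
      using gauge_radius_exists[OF d, of 1 "x - y"] unfolding L_def by auto
    have "gauge_norm (voronoi L) (x - y) \<ge> 2 * inner (x - y) n / inner n n"
      using t n False by (intro gauge_norm_voronoi_ge[of t]) auto
    \<comment> \<open>Different cells: \<open>x - y\<close> lies in the open region around
      \<open>n\<close>, hence strictly beyond the bisector of 0 and \<open>n\<close>, and its norm
      exceeds 1.\<close>
    moreover have "2 * inner (x - y) n > inner n n"
      using lt[of "- n"] n False by (simp add: L_def lattice_gen_minus inner_simps)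
    then have "2 * inner (x - y) n / inner n n > 1"
      using False by (simp add: less_divide_eq)
    ultimately show ?thesis by simp
  qed
qed

text \<open>The packing consists of cells around \<open>L\<close>; its translates by the four
  representatives 0, u/2, v/2, (u + v)/2 of the half lattice modulo \<open>L\<close> cover the plane
  off a null set.\<close>

lemma half_voronoi_packing_density:
  assumes d: "det2 u v \<noteq> 0"
  defines "L \<equiv> lattice_gen u v"
  shows "upper_density (half_voronoi_packing L) \<ge> ereal (1/4)"
proof -
  let ?A = "half_voronoi_packing L"
  have cL: "countable L" by (simp add: L_def countable_lattice_gen)
  have A: "?A \<in> sets lebesgue"
    by (rule half_voronoi_packing_sets[OF cL])
  \<comment> \<open>The points \<open>x\<close> for which \<open>2 *\<^sub>R x\<close> is
    equidistant from two lattice points \<open>p\<close> and \<open>p + m\<close>: countably many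
    lines.\<close>
  define N where "N = (\<Union>p\<in>L. \<Union>m\<in>L - {0}. {x. inner m x = inner m m / 4 + inner p m / 2})"
  have "negligible N"
    unfolding N_def using cL
    by (intro negligible_countable_Union countable_image countable_Diff) (auto intro!: negligible_countable_Union negligible_hyperplane)
  define h where "h = (\<lambda>i j :: int. (of_int i / 2) *\<^sub>R u + (of_int j / 2) *\<^sub>R v)"
  \<comment> \<open>Chosen so that four times the indicator of the packing plus \<open>g\<close>
    counts the four translates containing \<open>x\<close>, plus 1 on \<open>N\<close>.\<close>
  define g where "g x = (\<Sum>i\<in>{0,1}. \<Sum>j\<in>{0,1}. indicator ?A (x + (- h i j)) - indicator ?A x)
      + (indicator N x :: real)" for x
  have g: "mean_zero g"
    unfolding g_def
    by (intro mean_zero_add mean_zero_sum mean_zero_shift A mean_zero_negligible \<open>negligible N\<close>)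
  have cover: "\<exists>i\<in>{0,1}. \<exists>j\<in>{0,1}. x - h i j \<in> ?A" if "x \<notin> N" for x
  proof -
    \<comment> \<open>Half of \<open>p\<close> is a point of the half lattice closest to
      \<open>x\<close>. Splitting its coordinates by \<open>div\<close> and \<open>mod\<close> gives
      a lattice point \<open>l\<close> plus one of the four representatives.\<close>
    obtain p where p: "p \<in> L" "\<And>q. q \<in> L \<Longrightarrow> norm (2 *\<^sub>R x - p) \<le> norm (2 *\<^sub>R x - q)"
      using ex_closest_lattice_point[OF d] unfolding L_def by blast
    obtain m n where mn: "p = of_int m *\<^sub>R u + of_int n *\<^sub>R v"
      using p(1) by (auto simp: L_def lattice_gen_def)
    define l where "l = of_int (m div 2) *\<^sub>R u + of_int (n div 2) *\<^sub>R v"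
    have half: "real_of_int k / 2 = of_int (k div 2) + of_int (k mod 2) / 2" for k
    proof -
      have "k = 2 * (k div 2) + k mod 2" by simp
      then have "real_of_int k = 2 * of_int (k div 2) + of_int (k mod 2)"
        by (metis of_int_add of_int_mult of_int_numeral)
      then show ?thesis by simp
    qed
    have "(1/2) *\<^sub>R p = (of_int m / 2) *\<^sub>R u + (of_int n / 2) *\<^sub>R v"
      by (simp add: mn scaleR_add_right)
    also have "\<dots> = l + h (m mod 2) (n mod 2)"
      unfolding half[of m] half[of n] by (simp add: l_def h_def scaleR_add_left)
    finally have p_half: "(1/2) *\<^sub>R p = l + h (m mod 2) (n mod 2)" .
    have "4 * inner (x - h (m mod 2) (n mod 2) - l) q < inner q q" if q: "q \<in> L - {0}" for q
    proof -
      \<comment> \<open>Comparing \<open>p\<close> with \<open>p + q\<close> gives the weak cell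
        inequality in direction \<open>q\<close>; equality would put \<open>x\<close> into
        \<open>N\<close>.\<close>
      have "norm (2 *\<^sub>R x - p) \<le> norm (2 *\<^sub>R x - (p + q))"
        using p q by (simp add: L_def lattice_gen_add)
      then have "4 * inner x q - 2 * inner p q \<le> inner q q"
        by (simp add: norm_le inner_simps inner_commute algebra_simps)
      moreover have "4 * inner x q - 2 * inner p q \<noteq> inner q q"
      proof
        assume "4 * inner x q - 2 * inner p q = inner q q"
        then have "inner q x = inner q q / 4 + inner p q / 2"
          by (simp add: inner_commute)
        then show False
          using \<open>x \<notin> N\<close> p(1) q unfolding N_def by blast
      qed
      moreover have "inner (x - h (m mod 2) (n mod 2) - l) q = inner x q - inner p q / 2"
      proof -
        have "x - h (m mod 2) (n mod 2) - l = x - (1/2) *\<^sub>R p"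
          unfolding p_half by simp
        then show ?thesis by (simp only: inner_diff_left inner_scaleR_left)
      qed
      ultimately show ?thesis by linarith
    qed
    moreover have "l \<in> L"
      unfolding l_def L_def by (rule lattice_genI)
    ultimately have "x - h (m mod 2) (n mod 2) \<in> ?A"
      unfolding half_voronoi_packing_def by blast
    moreover have "m mod 2 \<in> {0,1}" "n mod 2 \<in> {0,1}"
      by auto
    ultimately show ?thesis by (intro bexI)
  qed
  have "1 \<le> 4 * indicator ?A x + g x" for x
  proof -
    have eq: "4 * indicator ?A x + g x = (\<Sum>i\<in>{0,1}. \<Sum>j\<in>{0,1}. indicator ?A (x - h i j)) + indicator N x"
      by (simp add: g_def)
    show ?thesis
    proof (cases "x \<in> N")
      case True
      then show ?thesis unfolding eq by (auto intro!: sum_nonneg add_increasing)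
    next
      case False
      then obtain i j where ij: "i \<in> {0,1}" "j \<in> {0,1}" "x - h i j \<in> ?A"
        using cover by blast
      have "1 \<le> (\<Sum>j\<in>{0,1}. indicator ?A (x - h i j) :: real)"
        using member_le_sum[of j "{0,1}" "\<lambda>j. indicator ?A (x - h i j) :: real"] ij by simp
      also have "\<dots> \<le> (\<Sum>i\<in>{0,1}. \<Sum>j\<in>{0,1}. indicator ?A (x - h i j))"
        using ij by (intro member_le_sum[where f = "\<lambda>i. \<Sum>j\<in>{0,1}. indicator ?A (x - h i j)"] sum_nonneg) auto
      finally show ?thesis
        unfolding eq by (simp add: indicator_def)
    qed
  qed
  then show ?thesis
    by (rule upper_density_ge[OF A g])
qed

section \<open>The value of \<open>m1\<close> from both bounds\<close>

theorem theorem3: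
  fixes L :: "(real^2) set"
  assumes "is_lattice2 L"
    and "is_hexagon (voronoi L)"
  shows "m1 (gauge_norm (voronoi L)) = ereal (1/4)"
proof (rule antisym)
  obtain b1 b2 where "independent {b1, b2}" "b1 \<noteq> b2" "L = lattice_gen b1 b2"
    using assms(1) by (auto simp: is_lattice2_def)
  then obtain u v where d: "det2 u v \<noteq> 0" and L: "L = lattice_gen u v"
    and ob: "inner u v \<le> 0" "inner u (- u - v) \<le> 0" "inner v (- u - v) \<le> 0"
    using obtuse_basis_exists[OF det2_neq_0] by metis
  show "m1 (gauge_norm (voronoi L)) \<le> ereal (1/4)"
    unfolding m1_def L by (rule Sup_least) (use upper_density_avoids_voronoi_le[OF d ob] in blast)
  have "ereal (1/4) \<le> upper_density (half_voronoi_packing L)"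
    unfolding L by (rule half_voronoi_packing_density[OF d])
  also have "\<dots> \<le> m1 (gauge_norm (voronoi L))"
    unfolding m1_def L
    by (rule Sup_upper)
       (use half_voronoi_packing_avoids[OF d] half_voronoi_packing_sets[OF countable_lattice_gen] in blast)
  finally show "ereal (1/4) \<le> m1 (gauge_norm (voronoi L))" .
qed

end
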